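(* Let $(X_1,\|\cdot\|)$ be a normed vector space with the associated metric $d_1(x_1,x_1'):=\|x_1-x_1'\|$, let $(X_2,d_2)$ be a metric space, let $\psi\in\mathbf{\Psi}_2$, and let $X:=X_1\times X_2$ be equipped with the metric $d_\psi$. Let $T:X\to X$ be given by $T(x_1,x_2):=(T_1(x_1,x_2),T_2(x_1,x_2))$ with $T_1:X\to X_1$ and $T_2:X\to X_2$. Let $\Omega$ be a nonempty bounded closed convex subset of $X_1$, and let $T^\Omega:=(T_1^\Omega,T_2)$ be the restriction of $T$ to $X_\Omega:=\Omega\times X_2$. Let $\lambda:=2\psi\left(\frac12,\frac12\right)$. Suppose that $X_1$ is a Banach space, that $X_2$ has the approximate fixed point property for Lipschitz continuous maps with constant $\lambda$, and that $T^\Omega$ is a nonexpansive map (with respect to $d_\psi$) satisfying $$\|T_1^\Omega(x_1,x_2)-T_1^\Omega(x'_1,x'_2)\|\le\frac{1}{\lambda}\cdot d_\psi((x_1,x_2),(x'_1,x'_2))$$ for all $(x_1,x_2),(x'_1,x'_2)\in X_\Omega$ with $\|x_1-x'_1\|\le d_2(x_2,x'_2)$. Then $T^\Omega$ has an approximate fixed point sequence.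
   Context: Let $\Omega_2:=\{(t_1,t_2)\in\mathbb{R}^2 \mid t_1,t_2\ge 0,\ t_1+t_2=1\}$. The class $\mathbf{\Psi}_2$ consists of all continuous convex functions $\psi:\Omega_2\to\mathbb{R}$ with $\psi(1,0)=\psi(0,1)=1$ such that for all $(t_1,t_2)\in\Omega_2$: $\psi(t_1,t_2)\ge(1-t_1)\,\psi\left(0,\frac{t_2}{1-t_1}\right)$ if $t_1<1$, and $\psi(t_1,t_2)\ge(1-t_2)\,\psi\left(\frac{t_1}{1-t_2},0\right)$ if $t_2<1$. For metric spaces $(X_1,d_1)$, $(X_2,d_2)$ and $\psi\in\mathbf{\Psi}_2$, the metric $d_\psi$ on $X_1\times X_2$ is defined by $d_\psi(x,y):=0$ if $x=y$ and, for $x=(x_1,x_2)\ne y=(y_1,y_2)$, with $D:=d_1(x_1,y_1)+d_2(x_2,y_2)$, $$d_\psi(x,y):=D\cdot\psi\left(\frac{d_1(x_1,y_1)}{D},\frac{d_2(x_2,y_2)}{D}\right).$$ A map $f:X\to Y$ between metric spaces is Lipschitz continuous with constant $\theta>0$ if $d(f(x),f(x'))\le\theta\, d(x,x')$ for all $x,x'\in X$; it is nonexpansive if this holds with $\theta=1$. For a map $f:X\to X$ on a metric space, a sequence $\{x_n\}\subset X$ is an approximate fixed point sequence of $f$ if $d(x_n,f(x_n))\to 0$ as $n\to\infty$; for $T^\Omega$ this means a sequence $\{y_n\}\subset X_\Omega$ with $d_\psi(y_n,T^\Omega(y_n))\to 0$. A metric space has the approximate fixed point property for a property $P$ if every self-map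 of the space possessing property $P$ admits an approximate fixed point sequence.
   Formalization: The formal theorem additionally assumes that T maps X_Ω into itself, so that T^Ω is a self-map; without this the claim fails, e.g. for X_1 = R, X_2 a point, Ω = [0,1], T_1 constantly 5. *)

theory Defs
  imports "HOL-Analysis.Analysis"
begin

definition Omega2 :: "(real \<times> real) set" where
  "Omega2 = {(t1, t2). 0 \<le> t1 \<and> 0 \<le> t2 \<and> t1 + t2 = 1}"

text \<open>Members of \<open>Psi2\<close> are total functions, but only their values on \<open>Omega2\<close> matter.\<close>

definition Psi2 :: "(real \<times> real \<Rightarrow> real) set" where
  "Psi2 = {\<psi>. continuous_on Omega2 \<psi> \<and> convex_on Omega2 \<psi> \<and> \<psi> (1, 0) = 1 \<and> \<psi> (0, 1) = 1 \<and>
     (\<forall>(t1, t2) \<in> Omega2.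
        (t1 < 1 \<longrightarrow> \<psi> (t1, t2) \<ge> (1 - t1) * \<psi> (0, t2 / (1 - t1))) \<and>
        (t2 < 1 \<longrightarrow> \<psi> (t1, t2) \<ge> (1 - t2) * \<psi> (t1 / (1 - t2), 0)))}"

text \<open>This is not the class distance \<^const>\<open>dist\<close> of the product type,
  which is Euclidean.\<close>

definition d_psi ::
  "(real \<times> real \<Rightarrow> real) \<Rightarrow> 'a::metric_space \<times> 'b::metric_space \<Rightarrow> 'a \<times> 'b \<Rightarrow> real" where
  "d_psi \<psi> x y =
     (if x = y then 0
      else let D = dist (fst x) (fst y) + dist (snd x) (snd y)
           in D * \<psi> (dist (fst x) (fst y) / D, dist (snd x) (snd y) / D))"

text \<open>The distance function is an explicit argument so that the following notions
  apply both to \<^const>\<open>dist\<close> and to \<^const>\<open>d_psi\<close>.\<close>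

definition nonexpansive_on :: "('c \<Rightarrow> 'c \<Rightarrow> real) \<Rightarrow> 'c set \<Rightarrow> ('c \<Rightarrow> 'c) \<Rightarrow> bool" where
  "nonexpansive_on d S f \<longleftrightarrow> (\<forall>x\<in>S. \<forall>y\<in>S. d (f x) (f y) \<le> d x y)"

definition approx_fixed_point_seq ::
  "('c \<Rightarrow> 'c \<Rightarrow> real) \<Rightarrow> 'c set \<Rightarrow> ('c \<Rightarrow> 'c) \<Rightarrow> (nat \<Rightarrow> 'c) \<Rightarrow> bool" where
  "approx_fixed_point_seq d S f y \<longleftrightarrow>
     (\<forall>n. y n \<in> S) \<and> (\<lambda>n. d (y n) (f (y n))) \<longlonglongrightarrow> 0"

definition approx_fixed_point_property ::
  "('c \<Rightarrow> 'c \<Rightarrow> real) \<Rightarrow> 'c set \<Rightarrow> (('c \<Rightarrow> 'c) \<Rightarrow> bool) \<Rightarrow> bool" where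
  "approx_fixed_point_property d S P \<longleftrightarrow>
     (\<forall>f. f \<in> S \<rightarrow> S \<and> P f \<longrightarrow> (\<exists>y. approx_fixed_point_seq d S f y))"

end

theory Submission
  imports Defs
begin

text \<open>
  Freeze the second coordinate \<open>y\<close>. Because \<open>d_psi\<close> agrees with the norm distance on pairs with
  equal second coordinates and dominates both coordinate distances (\<open>d_psi_same_snd\<close>,
  \<open>dist_fst_le_d_psi\<close>), the map \<open>f y = (\<lambda>x. T1 (x, y))\<close> is nonexpansive on the bounded convex
  set \<open>\<Omega>\<close>. Such a map has approximate fixed points: iterate the contraction
  \<open>x \<mapsto> (1 - t) f y x + t u\<close> from an anchor \<open>u\<close>. The error after \<open>k\<close> steps is at most
  \<open>((1 - t)^k + t) M\<close>, where \<open>M\<close> bounds the diameter of \<open>\<Omega>\<close>; it does not depend on \<open>y\<close>, so a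
  single choice of \<open>t\<close> and \<open>k\<close> gives a selection \<open>y \<mapsto> z y\<close> of \<open>e\<close>-fixed points of \<open>f y\<close>,
  simultaneously for all \<open>y\<close> (\<open>uniform_approximate_fixed_points\<close>).

  The selection is moreover nonexpansive in \<open>y\<close>. The iterations for \<open>y\<close> and \<open>y'\<close> start at the
  same anchor, and their distance never exceeds \<open>dist y y'\<close>: while this holds, the extra hypothesis
  on \<open>T1\<close> applies, and its factor \<open>1 / lam\<close> is what preserves the estimate in the next step
  (\<open>anchored_iterates_close\<close>), since \<open>d_psi \<le> lam * dist y y'\<close> whenever the second coordinate
  dominates (\<open>d_psi_le_dist_snd\<close>). The same bound makes \<open>g y = T2 (z y, y)\<close> a
  \<open>lam\<close>-Lipschitz self-map of the second space. Its approximate fixed points \<open>y\<close> yield approximate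
  fixed points \<open>(z y, y)\<close> of \<open>T\<close>, because \<open>d_psi\<close> is at most the sum of the coordinate distances.
\<close>

section \<open>The metric \<open>d_psi\<close> compared with the coordinate distances\<close>

text \<open>The upper bound is convexity between the two endpoints, where \<open>\<psi>\<close> is \<open>1\<close>; the lower bounds
  are the two growth conditions, which scale these endpoint values.\<close>

lemma Psi2_bounds:
  assumes "\<psi> \<in> Psi2" "0 \<le> s" "0 \<le> t" "s + t = 1"
  shows "\<psi> (s, t) \<le> 1" "s \<le> \<psi> (s, t)" "t \<le> \<psi> (s, t)"
proof -
  have cvx: "convex_on Omega2 \<psi>" and one: "\<psi> (1, 0) = 1" "\<psi> (0, 1) = 1"
    using assms(1) by (auto simp: Psi2_def)
  have mem: "(s, t) \<in> Omega2" "(1, 0) \<in> Omega2" "(0, 1) \<in> Omega2"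
    using assms by (auto simp: Omega2_def)
  have "\<psi> (s *\<^sub>R (1, 0) + t *\<^sub>R (0, 1)) \<le> s * \<psi> (1, 0) + t * \<psi> (0, 1)"
    using cvx mem assms unfolding convex_on_def by blast
  then show "\<psi> (s, t) \<le> 1"
    using one assms by simp
  have growth: "s < 1 \<longrightarrow> \<psi> (s, t) \<ge> (1 - s) * \<psi> (0, t / (1 - s))"
    "t < 1 \<longrightarrow> \<psi> (s, t) \<ge> (1 - t) * \<psi> (s / (1 - t), 0)"
    using assms(1) mem(1) by (auto simp: Psi2_def)
  show "s \<le> \<psi> (s, t)"
  proof (cases "t < 1")
    case True
    then have "1 - t = s" "s / (1 - t) = 1" using assms by auto
    then show ?thesis using growth(2) True one by simp
  next
    case False
    then have "s = 0" "t = 1" using assms by auto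
    then show ?thesis using one by simp
  qed
  show "t \<le> \<psi> (s, t)"
  proof (cases "s < 1")
    case True
    then have "1 - s = t" "t / (1 - s) = 1" using assms by auto
    then show ?thesis using growth(1) True one by simp
  next
    case False
    then have "t = 0" "s = 1" using assms by auto
    then show ?thesis using one by simp
  qed
qed

text \<open>Normalising the two coordinate distances gives a point of \<open>Omega2\<close>, which transfers bounds on
  \<open>\<psi>\<close> to bounds on \<open>d_psi\<close>.\<close>

lemma d_psi_cases:
  fixes x y :: "'a::metric_space \<times> 'b::metric_space"
  obtains "x = y" "d_psi \<psi> x y = 0"
  | D s t where "x \<noteq> y" "0 < D" "0 \<le> s" "0 \<le> t" "s + t = 1"
      "dist (fst x) (fst y) = D * s" "dist (snd x) (snd y) = D * t" "d_psi \<psi> x y = D * \<psi> (s, t)"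
proof (cases "x = y")
  case True
  then show ?thesis using that(1) by (simp add: d_psi_def)
next
  case False
  let ?D = "dist (fst x) (fst y) + dist (snd x) (snd y)"
  have "fst x \<noteq> fst y \<or> snd x \<noteq> snd y"
    using False by (simp add: prod_eq_iff)
  then have "?D > 0"
    by (auto intro: add_pos_nonneg add_nonneg_pos)
  then show ?thesis
    using False that(2)[of ?D "dist (fst x) (fst y) / ?D" "dist (snd x) (snd y) / ?D"]
    by (simp add: d_psi_def Let_def add_divide_distrib[symmetric])
qed

lemma dist_fst_le_d_psi:
  assumes "\<psi> \<in> Psi2"
  shows "dist (fst x) (fst y) \<le> d_psi \<psi> x y"
  by (cases rule: d_psi_cases[of x y \<psi>]) (use Psi2_bounds(2)[OF assms] in auto)

lemma dist_snd_le_d_psi: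
  assumes "\<psi> \<in> Psi2"
  shows "dist (snd x) (snd y) \<le> d_psi \<psi> x y"
  by (cases rule: d_psi_cases[of x y \<psi>]) (use Psi2_bounds(3)[OF assms] in auto)

lemma d_psi_le_sum:
  assumes "\<psi> \<in> Psi2"
  shows "d_psi \<psi> x y \<le> dist (fst x) (fst y) + dist (snd x) (snd y)"
proof (cases rule: d_psi_cases[of x y \<psi>])
  case (2 D s t)
  have "D * \<psi> (s, t) \<le> D * 1"
    using 2 Psi2_bounds(1)[OF assms, of s t] by (intro mult_left_mono) auto
  also have "\<dots> = D * s + D * t"
    using 2 by (simp add: distrib_left[symmetric])
  finally show ?thesis using 2 by simp
qed simp

lemma d_psi_nonneg:
  assumes "\<psi> \<in> Psi2"
  shows "0 \<le> d_psi \<psi> x y"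
  using dist_fst_le_d_psi[OF assms, of x y] zero_le_dist order_trans by blast

lemma d_psi_same_snd:
  assumes "\<psi> \<in> Psi2"
  shows "d_psi \<psi> (x, y) (x', y) = dist x x'"
  using dist_fst_le_d_psi[OF assms, of "(x, y)" "(x', y)"]
    d_psi_le_sum[OF assms, of "(x, y)" "(x', y)"] by simp

lemma one_le_twice_Psi2_midpoint:
  assumes "\<psi> \<in> Psi2"
  shows "1 \<le> 2 * \<psi> (1/2, 1/2)"
  using Psi2_bounds(2)[OF assms, of "1/2" "1/2"] by simp

text \<open>If the second coordinate dominates, then \<open>(s, t)\<close> lies between \<open>(0, 1)\<close> and the midpoint of
  \<open>Omega2\<close>. Hence convexity bounds \<open>\<psi> (s, t)\<close> by interpolating its values at these two points.\<close>

lemma d_psi_le_dist_snd: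
  assumes "\<psi> \<in> Psi2" "dist (fst x) (fst y) \<le> dist (snd x) (snd y)"
  shows "d_psi \<psi> x y \<le> 2 * \<psi> (1/2, 1/2) * dist (snd x) (snd y)"
proof (cases rule: d_psi_cases[of x y \<psi>])
  case (2 D s t)
  let ?l = "2 * \<psi> (1/2, 1/2)"
  have st: "s \<le> t" using 2 assms(2) by simp
  have cvx: "convex_on Omega2 \<psi>" and one: "\<psi> (0, 1) = 1"
    using assms(1) by (auto simp: Psi2_def)
  have mem: "(1/2, 1/2) \<in> Omega2" "(0, 1) \<in> Omega2"
    by (auto simp: Omega2_def)
  have "\<psi> ((2 * s) *\<^sub>R (1/2, 1/2) + (t - s) *\<^sub>R (0, 1))
      \<le> (2 * s) * \<psi> (1/2, 1/2) + (t - s) * \<psi> (0, 1)"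
  proof -
    have "0 \<le> 2 * s" "0 \<le> t - s" "2 * s + (t - s) = 1" using 2 st by auto
    then show ?thesis using cvx mem unfolding convex_on_def by blast
  qed
  then have "\<psi> (s, t) \<le> s * ?l + (t - s) * 1"
    using one by (simp add: field_simps)
  also have "\<dots> \<le> s * ?l + (t - s) * ?l"
    using st one_le_twice_Psi2_midpoint[OF assms(1)]
    by (intro add_left_mono mult_left_mono) auto
  also have "\<dots> = ?l * t" by (simp add: algebra_simps)
  finally have "D * \<psi> (s, t) \<le> D * (?l * t)"
    using 2 by (intro mult_left_mono) auto
  then show ?thesis using 2 by (simp add: mult_ac)
qed simp

section \<open>Anchored iteration of nonexpansive maps\<close>

text \<open>Picard iteration of the contraction \<open>x \<mapsto> (1 - t) f x + t u\<close>, started at the anchor itself.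
  The common starting point makes iterates of different maps comparable.\<close>

primrec anchored_iterate ::
  "real \<Rightarrow> 'a::real_vector \<Rightarrow> ('a \<Rightarrow> 'a) \<Rightarrow> nat \<Rightarrow> 'a" where
  "anchored_iterate t u f 0 = u"
| "anchored_iterate t u f (Suc k) = (1 - t) *\<^sub>R f (anchored_iterate t u f k) + t *\<^sub>R u"

lemma anchored_iterate_mem:
  assumes "convex S" "u \<in> S" "f \<in> S \<rightarrow> S" "0 \<le> t" "t \<le> 1"
  shows "anchored_iterate t u f k \<in> S"
proof (induction k)
  case (Suc k)
  then have "f (anchored_iterate t u f k) \<in> S" using assms(3) by blast
  then show ?case using assms convexD[of S _ u "1 - t" t] by simp
qed (use assms in simp)

text \<open>Consecutive iterates approach each other geometrically, and one step of the iteration differs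
  from one application of \<open>f\<close> only by \<open>t (u - f x)\<close>.\<close>

lemma anchored_iterate_error:
  fixes S :: "'a::real_normed_vector set"
  assumes S: "convex S" "u \<in> S" "f \<in> S \<rightarrow> S" "0 \<le> t" "t \<le> 1"
    and nonexp: "nonexpansive_on dist S f"
    and diam: "\<And>x x'. x \<in> S \<Longrightarrow> x' \<in> S \<Longrightarrow> dist x x' \<le> M"
  shows "dist (anchored_iterate t u f k) (f (anchored_iterate t u f k)) \<le> ((1 - t) ^ k + t) * M"
proof -
  let ?z = "anchored_iterate t u f"
  have mem: "?z k \<in> S" for k by (rule anchored_iterate_mem[OF S])
  have step: "dist (?z k) (?z (Suc k)) \<le> (1 - t) ^ k * M" for k
  proof (induction k)
    case 0
    then show ?case using diam[OF mem[of 0] mem[of "Suc 0"]] by simp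
  next
    case (Suc k)
    have "dist (?z (Suc k)) (?z (Suc (Suc k))) = dist ((1 - t) *\<^sub>R f (?z k)) ((1 - t) *\<^sub>R f (?z (Suc k)))"
      by simp
    also have "\<dots> = (1 - t) * dist (f (?z k)) (f (?z (Suc k)))"
      using S(5) by (simp add: dist_norm scaleR_diff_right[symmetric])
    also have "\<dots> \<le> (1 - t) * ((1 - t) ^ k * M)"
      using S(5) Suc order_trans[of "dist (f (?z k)) (f (?z (Suc k)))"] nonexp mem[of k] mem[of "Suc k"]
      unfolding nonexpansive_on_def by (intro mult_left_mono) (blast, simp)
    finally show ?case by (simp add: mult_ac)
  qed
  have "?z (Suc k) - f (?z k) = t *\<^sub>R (u - f (?z k))"
    by (simp add: algebra_simps)
  then have "dist (?z (Suc k)) (f (?z k)) = t * dist u (f (?z k))"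
    using S(4) by (simp add: dist_norm)
  also have "\<dots> \<le> t * M"
    using S mem diam[of u "f (?z k)"] by (intro mult_left_mono) auto
  finally have "dist (?z k) (f (?z k)) \<le> (1 - t) ^ k * M + t * M"
    using step[of k] dist_triangle[of "?z k" "f (?z k)" "?z (Suc k)"] by linarith
  then show ?thesis by (simp add: distrib_right)
qed

text \<open>The error bound involves the map only through its domain, so \<open>t\<close> and \<open>k\<close> can be chosen
  before \<open>f\<close>.\<close>

lemma uniform_approximate_fixed_points:
  fixes S :: "'a::real_normed_vector set"
  assumes S: "convex S" "bounded S" "u \<in> S" and "0 < e"
  obtains t k where "0 \<le> t" "t \<le> 1"
    "\<And>f. f \<in> S \<rightarrow> S \<Longrightarrow> nonexpansive_on dist S f \<Longrightarrow>
      dist (anchored_iterate t u f k) (f (anchored_iterate t u f k)) \<le> e"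
proof -
  define M where "M = diameter S + 1"
  have M: "0 < M" "\<And>x x'. x \<in> S \<Longrightarrow> x' \<in> S \<Longrightarrow> dist x x' \<le> M"
    using diameter_bounded_bound[OF S(2)] diameter_ge_0[OF S(2)] unfolding M_def
    by (auto intro: add_increasing2)
  \<comment> \<open>This \<open>t\<close> lies strictly between \<open>0\<close> and \<open>1\<close> and satisfies \<open>t * M \<le> e / 2\<close>.\<close>
  define t where "t = e / (2 * M + e)"
  have t: "0 < t" "t < 1" "t * M \<le> e / 2"
    using M(1) \<open>0 < e\<close> by (auto simp: t_def field_simps)
  obtain k where "(1 - t) ^ k < e / (2 * M)"
    using real_arch_pow_inv[of "e / (2 * M)" "1 - t"] t M(1) \<open>0 < e\<close> by auto
  then have "(1 - t) ^ k * M \<le> e / 2"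
    using M(1) by (simp add: field_simps)
  then have "((1 - t) ^ k + t) * M \<le> e"
    using t(3) by (simp add: distrib_right)
  show ?thesis
  proof (rule that[of t k])
    fix f
    assume "f \<in> S \<rightarrow> S" "nonexpansive_on dist S f"
    then have "dist (anchored_iterate t u f k) (f (anchored_iterate t u f k)) \<le> ((1 - t) ^ k + t) * M"
      using t M(2) by (intro anchored_iterate_error[OF S(1,3)]) auto
    also note \<open>((1 - t) ^ k + t) * M \<le> e\<close>
    finally show "dist (anchored_iterate t u f k) (f (anchored_iterate t u f k)) \<le> e" .
  qed (use t in auto)
qed

text \<open>Both iterations start at \<open>u\<close>, and in every step the anchor terms \<open>t u\<close> cancel, which leaves
  the distance of the two images multiplied by \<open>1 - t \<le> 1\<close>.\<close>

lemma anchored_iterates_close: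
  fixes S :: "'a::real_normed_vector set"
  assumes S: "convex S" "u \<in> S" "f \<in> S \<rightarrow> S" "g \<in> S \<rightarrow> S" "0 \<le> t" "t \<le> 1"
    and "0 \<le> r"
    and close: "\<And>x x'. x \<in> S \<Longrightarrow> x' \<in> S \<Longrightarrow> dist x x' \<le> r \<Longrightarrow> dist (f x) (g x') \<le> r"
  shows "dist (anchored_iterate t u f k) (anchored_iterate t u g k) \<le> r"
proof (induction k)
  case (Suc k)
  let ?x = "anchored_iterate t u f k" and ?y = "anchored_iterate t u g k"
  have "dist (f ?x) (g ?y) \<le> r"
    using Suc close anchored_iterate_mem S by blast
  have "dist (anchored_iterate t u f (Suc k)) (anchored_iterate t u g (Suc k))
      = (1 - t) * dist (f ?x) (g ?y)"
    using S(6) by (simp add: dist_norm scaleR_diff_right[symmetric])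
  also have "\<dots> \<le> 1 * r"
    using S(5,6) \<open>dist (f ?x) (g ?y) \<le> r\<close> by (intro mult_mono) auto
  finally show ?case by simp
qed (use \<open>0 \<le> r\<close> in simp)

section \<open>Approximate fixed points in the product\<close>

lemma approx_fixed_point_seqI:
  assumes nonneg: "\<And>x. x \<in> S \<Longrightarrow> 0 \<le> d x (f x)"
    and approx: "\<And>e. 0 < e \<Longrightarrow> \<exists>x\<in>S. d x (f x) < e"
  shows "\<exists>y. approx_fixed_point_seq d S f y"
proof -
  have "\<forall>n. \<exists>x\<in>S. d x (f x) < inverse (real (Suc n))"
    using approx by simp
  then obtain y where y: "\<And>n. y n \<in> S" "\<And>n. d (y n) (f (y n)) < inverse (real (Suc n))"
    by metis
  have "(\<lambda>n. d (y n) (f (y n))) \<longlonglongrightarrow> 0"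
    by (rule tendsto_sandwich[OF _ _ tendsto_const LIMSEQ_inverse_real_of_nat])
      (use y nonneg in \<open>auto intro!: always_eventually less_imp_le\<close>)
  then show ?thesis using y(1) by (auto simp: approx_fixed_point_seq_def)
qed

lemma approx_fixed_point_seqD:
  assumes "approx_fixed_point_seq d S f y" "0 < e"
  obtains n where "d (y n) (f (y n)) < e"
proof -
  have "(\<lambda>n. d (y n) (f (y n))) \<longlonglongrightarrow> 0"
    using assms(1) by (simp add: approx_fixed_point_seq_def)
  then have "\<forall>\<^sub>F n in sequentially. d (y n) (f (y n)) < e"
    using assms(2) by (rule order_tendstoD(2))
  then show ?thesis
    using that eventually_happens'[OF sequentially_bot] by blast
qed

theorem theorem5p2:
  fixes \<psi> :: "real \<times> real \<Rightarrow> real"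
    and T :: "'a::banach \<times> 'b::metric_space \<Rightarrow> 'a \<times> 'b"
    and T1 :: "'a \<times> 'b \<Rightarrow> 'a" and T2 :: "'a \<times> 'b \<Rightarrow> 'b"
    and \<Omega> :: "'a set" and lam :: real
  assumes psi: "\<psi> \<in> Psi2"
    and T: "\<And>x1 x2. T (x1, x2) = (T1 (x1, x2), T2 (x1, x2))"
    and Omega: "\<Omega> \<noteq> {}" "bounded \<Omega>" "closed \<Omega>" "convex \<Omega>"
    and self_map: "T \<in> \<Omega> \<times> UNIV \<rightarrow> \<Omega> \<times> UNIV"
    and lam: "lam = 2 * \<psi> (1/2, 1/2)"
    and X2: "approx_fixed_point_property dist (UNIV :: 'b set) (\<lambda>f. lam-lipschitz_on UNIV f)"
    and nonexp: "nonexpansive_on (d_psi \<psi>) (\<Omega> \<times> UNIV) T"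
    and T1: "\<And>x1 x2 x1' x2'. x1 \<in> \<Omega> \<Longrightarrow> x1' \<in> \<Omega> \<Longrightarrow> norm (x1 - x1') \<le> dist x2 x2' \<Longrightarrow>
      norm (T1 (x1, x2) - T1 (x1', x2')) \<le> 1 / lam * d_psi \<psi> (x1, x2) (x1', x2')"
  shows "\<exists>y. approx_fixed_point_seq (d_psi \<psi>) (\<Omega> \<times> UNIV) T y"
proof (rule approx_fixed_point_seqI)
  show "0 \<le> d_psi \<psi> x (T x)" for x
    by (rule d_psi_nonneg[OF psi])
next
  fix e :: real
  assume "0 < e"
  have lam1: "1 \<le> lam"
    using one_le_twice_Psi2_midpoint[OF psi] lam by simp
  obtain u where u: "u \<in> \<Omega>" using Omega(1) by blast
  have T1_mem: "T1 (x, y) \<in> \<Omega>" if "x \<in> \<Omega>" for x y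
    using funcset_mem[OF self_map, of "(x, y)"] that by (simp add: T)
  have T_nonexp: "d_psi \<psi> (T (x, y)) (T (x', y')) \<le> d_psi \<psi> (x, y) (x', y')"
    if "x \<in> \<Omega>" "x' \<in> \<Omega>" for x x' y y'
    using nonexp that unfolding nonexpansive_on_def by blast
  have d_bound: "d_psi \<psi> (x, y) (x', y') \<le> lam * dist y y'" if "dist x x' \<le> dist y y'" for x x' y y'
    using d_psi_le_dist_snd[OF psi, of "(x, y)" "(x', y')"] that lam by simp
  define f where "f y x = T1 (x, y)" for y x
  have f_self: "f y \<in> \<Omega> \<rightarrow> \<Omega>" for y
    using T1_mem by (auto simp: f_def)
  have f_nonexp: "nonexpansive_on dist \<Omega> (f y)" for y
    unfolding nonexpansive_on_def
  proof (intro ballI)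
    fix x x' assume "x \<in> \<Omega>" "x' \<in> \<Omega>"
    then show "dist (f y x) (f y x') \<le> dist x x'"
      using dist_fst_le_d_psi[OF psi, of "T (x, y)" "T (x', y)"] T_nonexp[of x x' y y]
      by (simp add: T f_def d_psi_same_snd[OF psi])
  qed
  \<comment> \<open>Here the factor \<open>1 / lam\<close> compensates the growth of \<open>d_psi\<close> over the second coordinate.\<close>
  have f_close: "dist (f y x) (f y' x') \<le> dist y y'"
    if "x \<in> \<Omega>" "x' \<in> \<Omega>" "dist x x' \<le> dist y y'" for x x' y y'
  proof -
    have "dist (f y x) (f y' x') \<le> 1 / lam * d_psi \<psi> (x, y) (x', y')"
      using T1[OF that(1,2), of y y'] that(3) by (simp add: dist_norm f_def)
    also have "\<dots> \<le> 1 / lam * (lam * dist y y')"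
      using d_bound[OF that(3)] lam1 by (intro mult_left_mono) auto
    finally show ?thesis using lam1 by simp
  qed
  have "0 < e / 2" using \<open>0 < e\<close> by simp
  then obtain t k where t: "0 \<le> t" "t \<le> 1" and approx: "\<And>h. h \<in> \<Omega> \<rightarrow> \<Omega> \<Longrightarrow>
      nonexpansive_on dist \<Omega> h \<Longrightarrow>
      dist (anchored_iterate t u h k) (h (anchored_iterate t u h k)) \<le> e / 2"
    using uniform_approximate_fixed_points[OF Omega(4,2) u] by metis
  define z where "z y = anchored_iterate t u (f y) k" for y
  have z_mem: "z y \<in> \<Omega>" for y
    unfolding z_def by (rule anchored_iterate_mem[OF Omega(4) u f_self t])
  have z_approx: "dist (z y) (T1 (z y, y)) \<le> e / 2" for y
    using approx[OF f_self f_nonexp, of y] by (simp add: z_def f_def)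
  have z_nonexp: "dist (z y) (z y') \<le> dist y y'" for y y'
    unfolding z_def
    by (rule anchored_iterates_close[OF Omega(4) u f_self f_self t zero_le_dist f_close])
  define g where "g y = T2 (z y, y)" for y
  have "lam-lipschitz_on UNIV g"
  proof (rule lipschitz_onI)
    fix y y' :: 'b
    have "dist (g y) (g y') \<le> d_psi \<psi> (T (z y, y)) (T (z y', y'))"
      using dist_snd_le_d_psi[OF psi, of "T (z y, y)" "T (z y', y')"] by (simp add: T g_def)
    also have "\<dots> \<le> d_psi \<psi> (z y, y) (z y', y')"
      by (rule T_nonexp[OF z_mem z_mem])
    also have "\<dots> \<le> lam * dist y y'"
      by (rule d_bound[OF z_nonexp])
    finally show "dist (g y) (g y') \<le> lam * dist y y'" .
  qed (use lam1 in simp)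
  then obtain w where "approx_fixed_point_seq dist UNIV g w"
    using X2 unfolding approx_fixed_point_property_def by auto
  then obtain n where n: "dist (w n) (g (w n)) < e / 2"
    using approx_fixed_point_seqD[of dist UNIV g w "e / 2"] \<open>0 < e\<close> by auto
  have "d_psi \<psi> (z (w n), w n) (T (z (w n), w n))
      \<le> dist (z (w n)) (T1 (z (w n), w n)) + dist (w n) (g (w n))"
    using d_psi_le_sum[OF psi, of "(z (w n), w n)" "T (z (w n), w n)"] by (simp add: T g_def)
  also have "\<dots> < e / 2 + e / 2"
    by (rule add_le_less_mono[OF z_approx n])
  finally show "\<exists>x\<in>\<Omega> \<times> UNIV. d_psi \<psi> x (T x) < e"
    using z_mem by (intro bexI[of _ "(z (w n), w n)"]) auto
qed

end
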